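(* Let $\beta>0$, and let $\Delta^w$ be the weighted discrete Laplacian matrix defined in the context. Let $\theta$ satisfy $$0<\theta<\frac{1}{\beta\,\|\Delta^w\|_\infty}.$$ Put $A=I-\beta\theta\Delta^w$ and consider the splitting $A=E-F$ with $E=I$ and $F=\beta\theta\Delta^w$. Then the spectral radius satisfies $\rho(E^{-1}F)<1$, and, for each right-hand side $B\in\mathbb{R}^{N^2}$ and each starting vector $X^{(0)}\in\mathbb{R}^{N^2}$, the iterative method $$X^{(m+1)}=F X^{(m)}+B,\qquad m=0,1,\ldots$$ converges to the solution of the linear system $AX=B$.
   Context: Let $N\ge 2$ and identify $N\times N$ real images $u=(u_{i,j})_{1\le i,j\le N}$ with vectors in $\mathbb{R}^{N^2}$ via $k=(i-1)N+j$. Let $u_x,u_y\in\mathbb{R}^{N^2}$ be the first-order differences of $u$ along the two coordinate directions: $(u_x)_{i,j}=u_{i,j}-u_{i,j-1}$ and $(u_y)_{i,j}=u_{i,j}-u_{i-1,j}$, with the convention that a difference involving a pixel outside the grid is set to $0$. Let $w^x_{i,j}>0$ and $w^y_{i,j}>0$ ($1\le i,j\le N$) be fixed positive constants (weights). In the paper they are values $\phi'_\mu(|g|)=\frac{1}{\mu\log 2}\,\frac{1}{1+e^{|g|/\mu}}$, with $\mu>0$ and $g$ the corresponding first-order difference, at pixel $(i,j)$, of a given fixed image. The weighted gradient operators $\nabla_x^w,\nabla_y^w$ are the $N^2\times N^2$ real matrices given by $(\nabla_x^w u)_{i,j}=w^x_{i,j}(u_x)_{i,j}$ and $(\nabla_y^w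 u)_{i,j}=w^y_{i,j}(u_y)_{i,j}$. The weighted Laplacian is the $N^2\times N^2$ matrix $$\Delta^w=-\left((\nabla_x^w)^T\nabla_x^w+(\nabla_y^w)^T\nabla_y^w\right).$$ $I$ is the $N^2\times N^2$ identity matrix, $\rho(\cdot)$ is the spectral radius, and $\|\cdot\|_\infty$ is the matrix norm induced by the vector $\infty$-norm (maximum absolute row sum). *)

theory Defs
  imports Complex_Main "Jordan_Normal_Form.Spectral_Radius"
begin

text \<open>
  Pixels \<open>(i, j)\<close> are numbered from 1, with \<open>1 \<le> i, j \<le> N\<close>, as in the mathematical text; the
  positions of an \<open>N\<^sup>2\<close>-vector are numbered from 0. Thus pixel \<open>(i, j)\<close> sits at position
  \<open>k - 1\<close> where \<open>k = (i - 1) N + j\<close>.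
\<close>

definition pixel_pos :: "nat \<Rightarrow> nat \<Rightarrow> nat \<Rightarrow> nat" where
  "pixel_pos N i j = (i - 1) * N + (j - 1)"

definition pixel_row :: "nat \<Rightarrow> nat \<Rightarrow> nat" where
  "pixel_row N k = k div N + 1"

definition pixel_col :: "nat \<Rightarrow> nat \<Rightarrow> nat" where
  "pixel_col N k = k mod N + 1"

definition diff_x :: "nat \<Rightarrow> real vec \<Rightarrow> nat \<Rightarrow> nat \<Rightarrow> real" where
  "diff_x N u i j = (if j = 1 then 0 else u $ pixel_pos N i j - u $ pixel_pos N i (j - 1))"

definition diff_y :: "nat \<Rightarrow> real vec \<Rightarrow> nat \<Rightarrow> nat \<Rightarrow> real" where
  "diff_y N u i j = (if i = 1 then 0 else u $ pixel_pos N i j - u $ pixel_pos N (i - 1) j)"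

text \<open>
  The matrices of the linear maps \<open>u \<mapsto> w\<^sup>x u\<^sub>x\<close> and \<open>u \<mapsto> w\<^sup>y u\<^sub>y\<close>: column \<open>l\<close> is the
  image of the \<open>l\<close>-th unit vector. Lemmas \<open>wgrad_x_mult_vec\<close> and \<open>wgrad_y_mult_vec\<close> below state
  the defining action on an arbitrary image.
\<close>

definition wgrad_x :: "nat \<Rightarrow> (nat \<Rightarrow> nat \<Rightarrow> real) \<Rightarrow> real mat" where
  "wgrad_x N wx = mat (N\<^sup>2) (N\<^sup>2) (\<lambda>(k, l).
     wx (pixel_row N k) (pixel_col N k) *
     diff_x N (unit_vec (N\<^sup>2) l) (pixel_row N k) (pixel_col N k))"

definition wgrad_y :: "nat \<Rightarrow> (nat \<Rightarrow> nat \<Rightarrow> real) \<Rightarrow> real mat" where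
  "wgrad_y N wy = mat (N\<^sup>2) (N\<^sup>2) (\<lambda>(k, l).
     wy (pixel_row N k) (pixel_col N k) *
     diff_y N (unit_vec (N\<^sup>2) l) (pixel_row N k) (pixel_col N k))"

definition wlaplacian ::
    "nat \<Rightarrow> (nat \<Rightarrow> nat \<Rightarrow> real) \<Rightarrow> (nat \<Rightarrow> nat \<Rightarrow> real) \<Rightarrow> real mat" where
  "wlaplacian N wx wy =
     - (transpose_mat (wgrad_x N wx) * wgrad_x N wx + transpose_mat (wgrad_y N wy) * wgrad_y N wy)"

definition vec_norm_inf :: "real vec \<Rightarrow> real" where
  "vec_norm_inf v = Max ((\<lambda>i. \<bar>v $ i\<bar>) ` {..<dim_vec v})"

definition mat_norm_inf :: "real mat \<Rightarrow> real" where
  "mat_norm_inf A =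
     (SUP v \<in> {v \<in> carrier_vec (dim_col A). v \<noteq> 0\<^sub>v (dim_col A)}.
        vec_norm_inf (A *\<^sub>v v) / vec_norm_inf v)"

text \<open>The library's spectral radius is defined for complex matrices only.\<close>

definition real_spectral_radius :: "real mat \<Rightarrow> real" where
  "real_spectral_radius A = spectral_radius (map_mat complex_of_real A)"

lemma pixel_pos_less:
  assumes "1 \<le> i" "i \<le> N" "1 \<le> j" "j \<le> N"
  shows "pixel_pos N i j < N\<^sup>2"
proof -
  have "(i - 1) * N + (j - 1) < (i - 1) * N + N" using assms by simp
  also have "\<dots> = i * N" using assms by (cases i) auto
  also have "\<dots> \<le> N * N" using assms by simp
  finally show ?thesis by (simp add: pixel_pos_def power2_eq_square)
qed

lemma pixel_row_col_pos:
  assumes "1 \<le> i" "i \<le> N" "1 \<le> j" "j \<le> N"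
  shows "pixel_row N (pixel_pos N i j) = i" "pixel_col N (pixel_pos N i j) = j"
proof -
  obtain a b where "i = Suc a" "j = Suc b" "b < N" using assms by (cases i; cases j) auto
  then show "pixel_row N (pixel_pos N i j) = i" "pixel_col N (pixel_pos N i j) = j"
    by (simp_all add: pixel_row_def pixel_col_def pixel_pos_def)
qed

lemma sum_unit_vec:
  assumes "u \<in> carrier_vec n" "p < n"
  shows "(\<Sum>l<n. unit_vec n l $ p * u $ l) = (u $ p :: real)"
proof -
  have "(\<Sum>l<n. unit_vec n l $ p * u $ l) = (\<Sum>l<n. if l = p then u $ l else 0)"
    using assms by (intro sum.cong) auto
  then show ?thesis using assms by simp
qed

lemma wgrad_x_mult_vec:
  assumes u: "u \<in> carrier_vec (N\<^sup>2)" and ij: "1 \<le> i" "i \<le> N" "1 \<le> j" "j \<le> N"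
  shows "(wgrad_x N wx *\<^sub>v u) $ pixel_pos N i j = wx i j * diff_x N u i j"
proof -
  have p: "pixel_pos N i j < N\<^sup>2" and q: "j \<noteq> 1 \<Longrightarrow> pixel_pos N i (j - 1) < N\<^sup>2"
    using ij by (auto intro!: pixel_pos_less)
  have "(wgrad_x N wx *\<^sub>v u) $ pixel_pos N i j
      = (\<Sum>l<N\<^sup>2. wx i j * diff_x N (unit_vec (N\<^sup>2) l) i j * u $ l)"
    using p u by (simp add: wgrad_x_def scalar_prod_def pixel_row_col_pos[OF ij] lessThan_atLeast0)
  also have "\<dots> = wx i j * (\<Sum>l<N\<^sup>2. diff_x N (unit_vec (N\<^sup>2) l) i j * u $ l)"
    by (simp add: sum_distrib_left mult.assoc)
  also have "(\<Sum>l<N\<^sup>2. diff_x N (unit_vec (N\<^sup>2) l) i j * u $ l) = diff_x N u i j"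
    using sum_unit_vec[OF u p] sum_unit_vec[OF u q]
    by (cases "j = 1") (simp_all add: diff_x_def left_diff_distrib sum_subtractf del: index_unit_vec)
  finally show ?thesis .
qed

lemma wgrad_y_mult_vec:
  assumes u: "u \<in> carrier_vec (N\<^sup>2)" and ij: "1 \<le> i" "i \<le> N" "1 \<le> j" "j \<le> N"
  shows "(wgrad_y N wy *\<^sub>v u) $ pixel_pos N i j = wy i j * diff_y N u i j"
proof -
  have p: "pixel_pos N i j < N\<^sup>2" and q: "i \<noteq> 1 \<Longrightarrow> pixel_pos N (i - 1) j < N\<^sup>2"
    using ij by (auto intro!: pixel_pos_less)
  have "(wgrad_y N wy *\<^sub>v u) $ pixel_pos N i j
      = (\<Sum>l<N\<^sup>2. wy i j * diff_y N (unit_vec (N\<^sup>2) l) i j * u $ l)"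
    using p u by (simp add: wgrad_y_def scalar_prod_def pixel_row_col_pos[OF ij] lessThan_atLeast0)
  also have "\<dots> = wy i j * (\<Sum>l<N\<^sup>2. diff_y N (unit_vec (N\<^sup>2) l) i j * u $ l)"
    by (simp add: sum_distrib_left mult.assoc)
  also have "(\<Sum>l<N\<^sup>2. diff_y N (unit_vec (N\<^sup>2) l) i j * u $ l) = diff_y N u i j"
    using sum_unit_vec[OF u p] sum_unit_vec[OF u q]
    by (cases "i = 1") (simp_all add: diff_y_def left_diff_distrib sum_subtractf del: index_unit_vec)
  finally show ?thesis .
qed

lemma vec_norm_inf_ge: "i < dim_vec v \<Longrightarrow> \<bar>v $ i\<bar> \<le> vec_norm_inf v"
  unfolding vec_norm_inf_def by (intro Max_ge) auto

lemma vec_norm_inf_pos: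
  assumes "v \<in> carrier_vec n" "v \<noteq> 0\<^sub>v n"
  shows "0 < vec_norm_inf v"
proof -
  obtain i where i: "i < n" "v $ i \<noteq> 0" using assms by (auto simp: vec_eq_iff)
  then show ?thesis using vec_norm_inf_ge[of i v] assms by auto
qed

lemma mat_norm_inf_eq_max_row_sum:
  assumes A: "A \<in> carrier_mat n m" and n: "0 < n" and m: "0 < m"
  shows "mat_norm_inf A = Max ((\<lambda>i. \<Sum>j<m. \<bar>A $$ (i, j)\<bar>) ` {..<n})" (is "_ = ?M")
proof -
  have Mge: "(\<Sum>j<m. \<bar>A $$ (i, j)\<bar>) \<le> ?M" if "i < n" for i
    using that by (intro Max_ge) auto
  have comp: "(A *\<^sub>v v) $ i = (\<Sum>j<m. A $$ (i, j) * v $ j)"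
    if "v \<in> carrier_vec m" "i < n" for v i
    using that A by (simp add: scalar_prod_def lessThan_atLeast0)
  have ub: "vec_norm_inf (A *\<^sub>v v) / vec_norm_inf v \<le> ?M"
    if v: "v \<in> carrier_vec m" "v \<noteq> 0\<^sub>v m" for v
  proof -
    have pos: "0 < vec_norm_inf v" by (rule vec_norm_inf_pos[OF v])
    have "\<bar>(A *\<^sub>v v) $ i\<bar> \<le> ?M * vec_norm_inf v" if i: "i < n" for i
    proof -
      have "\<bar>(A *\<^sub>v v) $ i\<bar> \<le> (\<Sum>j<m. \<bar>A $$ (i, j)\<bar> * \<bar>v $ j\<bar>)"
        unfolding comp[OF v(1) i] abs_mult[symmetric] by (rule sum_abs)
      also have "\<dots> \<le> (\<Sum>j<m. \<bar>A $$ (i, j)\<bar> * vec_norm_inf v)"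
        using v by (intro sum_mono mult_left_mono vec_norm_inf_ge) auto
      also have "\<dots> = (\<Sum>j<m. \<bar>A $$ (i, j)\<bar>) * vec_norm_inf v"
        by (simp add: sum_distrib_right)
      also have "\<dots> \<le> ?M * vec_norm_inf v"
        using pos Mge[OF i] by (intro mult_right_mono) auto
      finally show ?thesis .
    qed
    then have "vec_norm_inf (A *\<^sub>v v) \<le> ?M * vec_norm_inf v"
      unfolding vec_norm_inf_def[of "A *\<^sub>v v"] using A n by (subst Max_le_iff) auto
    then show ?thesis using pos by (simp add: divide_le_eq)
  qed
  have "?M \<in> (\<lambda>i. \<Sum>j<m. \<bar>A $$ (i, j)\<bar>) ` {..<n}" using n by (intro Max_in) auto
  then obtain i where i: "i < n" "?M = (\<Sum>j<m. \<bar>A $$ (i, j)\<bar>)" by auto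
  define s where "s = vec m (\<lambda>j. if A $$ (i, j) < 0 then -1 else 1 :: real)"
  have s: "s \<in> carrier_vec m" by (simp add: s_def)
  have sj: "\<bar>s $ j\<bar> = 1" if "j < m" for j using that by (simp add: s_def)
  have s0: "s \<noteq> 0\<^sub>v m" using sj[OF m] m by auto
  have "(\<lambda>j. \<bar>s $ j\<bar>) ` {..<dim_vec s} = {1}" using sj s m by (auto simp: image_iff)
  then have s1: "vec_norm_inf s = 1" by (simp add: vec_norm_inf_def)
  have "(A *\<^sub>v s) $ i = ?M"
    unfolding comp[OF s i(1)] i(2) by (intro sum.cong) (auto simp: s_def)
  then have lb: "?M \<le> vec_norm_inf (A *\<^sub>v s) / vec_norm_inf s"
    using vec_norm_inf_ge[of i "A *\<^sub>v s"] A i(1) s1 by simp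
  show ?thesis unfolding mat_norm_inf_def
  proof (rule cSup_eq_maximum)
    have "vec_norm_inf (A *\<^sub>v s) / vec_norm_inf s = ?M" using lb ub[OF s s0] by simp
    then show "?M \<in> (\<lambda>v. vec_norm_inf (A *\<^sub>v v) / vec_norm_inf v) `
        {v \<in> carrier_vec (dim_col A). v \<noteq> 0\<^sub>v (dim_col A)}"
      using s s0 A by (intro image_eqI[of _ _ s]) auto
  qed (use ub A in auto)
qed

end

theory Submission
  imports Defs
begin

text \<open>
  The induced maximum norm is the maximum absolute row sum, so the step-size condition bounds
  the absolute row sums of \<open>F = \<beta>\<theta>\<Delta>\<^sup>w\<close> by \<open>q = \<beta>\<theta>\<parallel>\<Delta>\<^sup>w\<parallel>\<^sub>\<infinity> < 1\<close>, and \<open>F\<close> contracts the maximum norm. Everything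
  follows from this. Looking at an entry of largest modulus of an eigenvector shows that all
  eigenvalues of \<open>F\<close>, real or complex, have modulus at most \<open>q\<close>
  (\<open>eigenvalue_norm_le_row_sum\<close>); this bounds the spectral radius, and, as \<open>1\<close> is then not an
  eigenvalue, it makes \<open>I - F\<close> injective and hence invertible
  (\<open>one_minus_mat_unique_solution\<close>). The solution of \<open>(I - F) X = B\<close> is the fixed point of
  \<open>X \<mapsto> F X + B\<close>, and the error of the iteration shrinks at least by the factor \<open>q\<close> in each step
  (\<open>affine_iteration_tendsto\<close>).
\<close>

lemma norm_mult_vec_index_le:
  fixes M :: "'a :: real_normed_field mat"
  assumes M: "M \<in> carrier_mat n m" and v: "v \<in> carrier_vec m" and i: "i < n"
    and row: "(\<Sum>j<m. norm (M $$ (i, j))) \<le> q"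
    and r: "\<And>j. j < m \<Longrightarrow> norm (v $ j) \<le> r" and "0 \<le> r"
  shows "norm ((M *\<^sub>v v) $ i) \<le> q * r"
proof -
  have "(M *\<^sub>v v) $ i = (\<Sum>j<m. M $$ (i, j) * v $ j)"
    using M v i by (simp add: scalar_prod_def lessThan_atLeast0)
  also have "norm \<dots> \<le> (\<Sum>j<m. norm (M $$ (i, j)) * norm (v $ j))"
    by (rule norm_sum[THEN order_trans]) (simp add: norm_mult)
  also have "\<dots> \<le> (\<Sum>j<m. norm (M $$ (i, j)) * r)"
    by (intro sum_mono mult_left_mono r) auto
  also have "\<dots> = (\<Sum>j<m. norm (M $$ (i, j))) * r"
    by (simp add: sum_distrib_right)
  also have "\<dots> \<le> q * r"
    using row \<open>0 \<le> r\<close> by (rule mult_right_mono)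
  finally show ?thesis .
qed

text \<open>
  Compare both sides of \<open>M v = \<lambda> v\<close> at an entry where \<open>v\<close> has largest modulus. The lemma is
  stated over an arbitrary normed field because it serves twice: over the complex numbers for
  the spectral radius, and over the reals for the injectivity of \<open>I - M\<close>.
\<close>
lemma eigenvalue_norm_le_row_sum:
  fixes M :: "'a :: real_normed_field mat"
  assumes M: "M \<in> carrier_mat n n"
    and row: "\<And>i. i < n \<Longrightarrow> (\<Sum>j<n. norm (M $$ (i, j))) \<le> q"
    and ev: "eigenvalue M l"
  shows "norm l \<le> q"
proof -
  obtain v where v: "v \<in> carrier_vec n" "v \<noteq> 0\<^sub>v n" "M *\<^sub>v v = l \<cdot>\<^sub>v v"
    using ev M unfolding eigenvalue_def eigenvector_def by auto
  obtain i where i: "i < n" "v $ i \<noteq> 0" using v by (auto simp: vec_eq_iff)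
  obtain k where k: "k < n" "\<And>j. j < n \<Longrightarrow> norm (v $ j) \<le> norm (v $ k)"
  proof -
    let ?S = "(\<lambda>j. norm (v $ j)) ` {..<n}"
    have "Max ?S \<in> ?S" using i(1) by (intro Max_in) auto
    then obtain k where "k < n" "norm (v $ k) = Max ?S" by auto
    then show thesis using that[of k] by auto
  qed
  have "norm ((M *\<^sub>v v) $ k) \<le> q * norm (v $ k)"
    by (rule norm_mult_vec_index_le[OF M v(1) k(1) row[OF k(1)] k(2)]) auto
  then have "norm l * norm (v $ k) \<le> q * norm (v $ k)"
    using v k(1) by (simp add: norm_mult)
  moreover have "0 < norm (v $ k)" using k(2)[OF i(1)] i(2) by (metis less_le_trans zero_less_norm_iff)
  ultimately show ?thesis by simp
qed

lemma real_spectral_radius_le_row_sum: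
  fixes M :: "real mat"
  assumes M: "M \<in> carrier_mat n n" and n: "0 < n"
    and row: "\<And>i. i < n \<Longrightarrow> (\<Sum>j<n. \<bar>M $$ (i, j)\<bar>) \<le> q"
  shows "real_spectral_radius M \<le> q"
proof -
  let ?C = "map_mat complex_of_real M"
  have C: "?C \<in> carrier_mat n n" using M by simp
  obtain l where l: "eigenvalue ?C l" "real_spectral_radius M = norm l"
    using spectral_radius_mem_max(1)[OF C n]
    by (auto simp: real_spectral_radius_def spectrum_def)
  have "norm l \<le> q"
  proof (rule eigenvalue_norm_le_row_sum[OF C _ l(1)])
    fix i assume i: "i < n"
    have "(\<Sum>j<n. norm (?C $$ (i, j))) = (\<Sum>j<n. \<bar>M $$ (i, j)\<bar>)"
      using M i by (intro sum.cong) auto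
    then show "(\<Sum>j<n. norm (?C $$ (i, j))) \<le> q" using row[OF i] by simp
  qed
  then show ?thesis using l by simp
qed

text \<open>
  A kernel vector of \<open>I - M\<close> would be an eigenvector of \<open>M\<close> for the eigenvalue \<open>1\<close>, which is too
  large; so the determinant does not vanish.
\<close>
lemma one_minus_mat_unique_solution:
  fixes M :: "real mat"
  assumes M: "M \<in> carrier_mat n n" and q: "q < 1"
    and row: "\<And>i. i < n \<Longrightarrow> (\<Sum>j<n. \<bar>M $$ (i, j)\<bar>) \<le> q"
    and b: "b \<in> carrier_vec n"
  shows "\<exists>!x. x \<in> carrier_vec n \<and> (1\<^sub>m n - M) *\<^sub>v x = b"
proof -
  let ?A = "1\<^sub>m n - M"
  have A: "?A \<in> carrier_mat n n" using M by auto
  have "det ?A \<noteq> 0"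
  proof
    assume "det ?A = 0"
    then obtain v where v: "v \<in> carrier_vec n" "v \<noteq> 0\<^sub>v n" "?A *\<^sub>v v = 0\<^sub>v n"
      using det_0_iff_vec_prod_zero[OF A] by auto
    have "v - M *\<^sub>v v = 0\<^sub>v n"
      using v M by (simp add: minus_mult_distrib_mat_vec[of _ n n])
    then have "M *\<^sub>v v = 1 \<cdot>\<^sub>v v"
      using v(1) M by (auto simp: vec_eq_iff)
    then have "eigenvalue M 1"
      using v M unfolding eigenvalue_def eigenvector_def by auto
    from eigenvalue_norm_le_row_sum[OF M _ this, of q] row q show False by simp
  qed
  from det_non_zero_imp_unit[OF A this]
  obtain C where C: "C \<in> carrier_mat n n" "C * ?A = 1\<^sub>m n" "?A * C = 1\<^sub>m n"
    by (auto simp: Units_def ring_mat_simps)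
  show ?thesis
  proof (rule ex1I[of _ "C *\<^sub>v b"])
    show "C *\<^sub>v b \<in> carrier_vec n \<and> ?A *\<^sub>v (C *\<^sub>v b) = b"
      using C b assoc_mult_mat_vec[OF A C(1) b] by simp
    show "x = C *\<^sub>v b" if "x \<in> carrier_vec n \<and> ?A *\<^sub>v x = b" for x
      using that C assoc_mult_mat_vec[OF C(1) A, of x] by auto
  qed
qed

text \<open>
  The error \<open>X m - x\<close> is multiplied by \<open>M\<close> in each step. The constant \<open>R\<close> below bounds the entries
  of the initial error; then \<open>q\<^sup>m R\<close> bounds those of the \<open>m\<close>-th error.
\<close>
lemma affine_iteration_tendsto:
  fixes M :: "real mat" and X :: "nat \<Rightarrow> real vec"
  assumes M: "M \<in> carrier_mat n n" and q: "0 \<le> q" "q < 1"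
    and row: "\<And>i. i < n \<Longrightarrow> (\<Sum>j<n. \<bar>M $$ (i, j)\<bar>) \<le> q"
    and b: "b \<in> carrier_vec n"
    and x: "x \<in> carrier_vec n" "x = M *\<^sub>v x + b"
    and X0: "X 0 \<in> carrier_vec n" and XSuc: "\<And>m. X (Suc m) = M *\<^sub>v X m + b"
    and k: "k < n"
  shows "(\<lambda>m. X m $ k) \<longlonglongrightarrow> x $ k"
proof -
  have X: "X m \<in> carrier_vec n" for m
    using M b X0 XSuc by (induction m) (auto intro!: add_carrier_vec mult_mat_vec_carrier)
  define R where "R = (\<Sum>j<n. \<bar>(X 0 - x) $ j\<bar>)"
  have R: "0 \<le> R" unfolding R_def by (rule sum_nonneg) simp
  have step: "X (Suc m) - x = M *\<^sub>v (X m - x)" for m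
  proof -
    have "X (Suc m) - x = (M *\<^sub>v X m + b) - (M *\<^sub>v x + b)"
      by (simp only: XSuc x(2)[symmetric])
    also have "\<dots> = M *\<^sub>v X m - M *\<^sub>v x"
      using M X[of m] x(1) b by (intro eq_vecI) auto
    also have "\<dots> = M *\<^sub>v (X m - x)"
      using M X[of m] x(1) by (simp add: mult_minus_distrib_mat_vec[of _ n n])
    finally show ?thesis .
  qed
  have bound: "\<bar>(X m - x) $ i\<bar> \<le> q ^ m * R" if "i < n" for m i
    using that
  proof (induction m arbitrary: i)
    case 0
    then show ?case
      using member_le_sum[of i "{..<n}" "\<lambda>j. \<bar>(X 0 - x) $ j\<bar>"] by (simp add: R_def)
  next
    case (Suc m)
    have "norm ((M *\<^sub>v (X m - x)) $ i) \<le> q * (q ^ m * R)"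
      using Suc X[of m] x(1) row[of i] q(1) R
      by (intro norm_mult_vec_index_le[OF M]) auto
    then show ?case by (simp add: step mult.assoc)
  qed
  have "(\<lambda>m. q ^ m * R) \<longlonglongrightarrow> 0"
    using LIMSEQ_power_zero[of q] q by (intro tendsto_mult_left_zero) auto
  then have "(\<lambda>m. X m $ k - x $ k) \<longlonglongrightarrow> 0"
  proof (rule tendsto_0_le)
    show "\<forall>\<^sub>F m in sequentially. norm (X m $ k - x $ k) \<le> norm (q ^ m * R) * 1"
      using bound[OF k] k x(1) X q(1) R by (intro always_eventually) (auto simp: abs_mult)
  qed
  then show ?thesis by (simp add: LIM_zero_iff)
qed

lemma mat_inverse_one: "mat_inverse (1\<^sub>m n :: 'a :: field mat) = Some (1\<^sub>m n)"
proof (cases "mat_inverse (1\<^sub>m n :: 'a mat)")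
  case None
  then show ?thesis
    using mat_inverse(1)[of "1\<^sub>m n :: 'a mat" n undefined]
    by (auto simp: Units_def ring_mat_simps)
next
  case (Some C)
  then show ?thesis using mat_inverse(2)[of "1\<^sub>m n :: 'a mat" n C] by auto
qed

theorem theorem4p1:
  fixes N :: nat and wx wy :: "nat \<Rightarrow> nat \<Rightarrow> real" and \<beta> \<theta> :: real and A E F :: "real mat"
  assumes "N \<ge> 2"
    and "\<And>i j. 1 \<le> i \<Longrightarrow> i \<le> N \<Longrightarrow> 1 \<le> j \<Longrightarrow> j \<le> N \<Longrightarrow> wx i j > 0"
    and "\<And>i j. 1 \<le> i \<Longrightarrow> i \<le> N \<Longrightarrow> 1 \<le> j \<Longrightarrow> j \<le> N \<Longrightarrow> wy i j > 0"
    and "\<beta> > 0"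
    and "0 < \<theta>" and "\<theta> < 1 / (\<beta> * mat_norm_inf (wlaplacian N wx wy))"
    and "A = 1\<^sub>m (N\<^sup>2) - (\<beta> * \<theta>) \<cdot>\<^sub>m wlaplacian N wx wy"
    and "E = 1\<^sub>m (N\<^sup>2)"
    and "F = (\<beta> * \<theta>) \<cdot>\<^sub>m wlaplacian N wx wy"
  shows "A = E - F \<and>
    (\<exists>Einv. mat_inverse E = Some Einv \<and> real_spectral_radius (Einv * F) < 1) \<and>
    (\<forall>B \<in> carrier_vec (N\<^sup>2).
       \<exists>Xsol \<in> carrier_vec (N\<^sup>2).
         A *\<^sub>v Xsol = B \<and>
         (\<forall>Y \<in> carrier_vec (N\<^sup>2). A *\<^sub>v Y = B \<longrightarrow> Y = Xsol) \<and>
         (\<forall>X :: nat \<Rightarrow> real vec.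
            X 0 \<in> carrier_vec (N\<^sup>2) \<and> (\<forall>m. X (Suc m) = F *\<^sub>v X m + B) \<longrightarrow>
            (\<forall>k < N\<^sup>2. (\<lambda>m. X m $ k) \<longlonglongrightarrow> Xsol $ k)))"
proof -
  define n where "n = N\<^sup>2"
  define L where "L = wlaplacian N wx wy"
  define q where "q = \<beta> * \<theta> * mat_norm_inf L"
  have n: "0 < n" using assms(1) by (simp add: n_def)
  have L: "L \<in> carrier_mat n n"
    unfolding L_def n_def wlaplacian_def
    by (intro uminus_carrier_mat add_carrier_mat mult_carrier_mat[of _ _ "N\<^sup>2"])
      (auto simp: wgrad_x_def wgrad_y_def)
  have F: "F \<in> carrier_mat n n" using L assms(9) by (simp add: L_def)
  have AEF: "A = 1\<^sub>m n - F" using assms by (simp add: n_def)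
  \<comment> \<open>A norm that is not positive would make the bound on \<open>\<theta>\<close> nonpositive; in particular the
    junk value \<open>1 / 0 = 0\<close> is harmless.\<close>
  have "0 < 1 / (\<beta> * mat_norm_inf L)"
    unfolding L_def using assms(5,6) by (rule less_trans)
  then have pos: "0 < \<beta> * mat_norm_inf L" by (simp only: zero_less_divide_1_iff)
  have q: "0 \<le> q" "q < 1"
  proof -
    have "q = \<theta> * (\<beta> * mat_norm_inf L)" by (simp add: q_def)
    then show "0 \<le> q" "q < 1"
      using pos assms(5,6) by (simp_all add: L_def pos_less_divide_eq)
  qed
  have row: "(\<Sum>j<n. \<bar>F $$ (i, j)\<bar>) \<le> q" if i: "i < n" for i
  proof -
    have "(\<Sum>j<n. \<bar>F $$ (i, j)\<bar>) = (\<Sum>j<n. \<beta> * \<theta> * \<bar>L $$ (i, j)\<bar>)"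
      using L i assms(4,5,9) by (intro sum.cong) (auto simp: L_def abs_mult)
    also have "\<dots> = \<beta> * \<theta> * (\<Sum>j<n. \<bar>L $$ (i, j)\<bar>)"
      by (simp add: sum_distrib_left)
    also have "\<dots> \<le> q"
      unfolding q_def mat_norm_inf_eq_max_row_sum[OF L n n]
      using i assms(4,5) by (intro mult_left_mono Max_ge) auto
    finally show ?thesis .
  qed
  have "real_spectral_radius (1\<^sub>m n * F) < 1"
    using real_spectral_radius_le_row_sum[OF F n row] q F by simp
  then have "\<exists>Einv. mat_inverse E = Some Einv \<and> real_spectral_radius (Einv * F) < 1"
    using mat_inverse_one[of n] assms(8) by (auto simp: n_def)
  moreover have "\<exists>Xsol \<in> carrier_vec n. A *\<^sub>v Xsol = B \<and>
      (\<forall>Y \<in> carrier_vec n. A *\<^sub>v Y = B \<longrightarrow> Y = Xsol) \<and>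
      (\<forall>X :: nat \<Rightarrow> real vec. X 0 \<in> carrier_vec n \<and> (\<forall>m. X (Suc m) = F *\<^sub>v X m + B) \<longrightarrow>
        (\<forall>k < n. (\<lambda>m. X m $ k) \<longlonglongrightarrow> Xsol $ k))"
    if B: "B \<in> carrier_vec n" for B
  proof -
    obtain x where x: "x \<in> carrier_vec n" "A *\<^sub>v x = B"
      and uniq: "\<And>y. y \<in> carrier_vec n \<Longrightarrow> A *\<^sub>v y = B \<Longrightarrow> y = x"
      using one_minus_mat_unique_solution[OF F q(2) row B] unfolding AEF by blast
    have B_eq: "B = x - F *\<^sub>v x"
      using x F by (simp add: AEF minus_mult_distrib_mat_vec[of _ n n])
    have fixpoint: "x = F *\<^sub>v x + B"
      unfolding B_eq using x(1) F by (intro eq_vecI) auto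
    have lim: "(\<lambda>m. X m $ k) \<longlonglongrightarrow> x $ k"
      if "X 0 \<in> carrier_vec n" "\<forall>m. X (Suc m) = F *\<^sub>v X m + B" "k < n"
      for X :: "nat \<Rightarrow> real vec" and k
      by (rule affine_iteration_tendsto[OF F q row B x(1) fixpoint]) (use that in auto)
    show ?thesis
    proof (intro bexI[of _ x] conjI ballI allI impI)
      show "A *\<^sub>v x = B" "x \<in> carrier_vec n" by (fact x)+
      show "y = x" if "y \<in> carrier_vec n" "A *\<^sub>v y = B" for y
        using that by (rule uniq)
      show "(\<lambda>m. X m $ k) \<longlonglongrightarrow> x $ k"
        if "X 0 \<in> carrier_vec n \<and> (\<forall>m. X (Suc m) = F *\<^sub>v X m + B)" "k < n"
        for X :: "nat \<Rightarrow> real vec" and k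
        using that by (elim conjE) (rule lim)
    qed
  qed
  moreover have "A = E - F" using AEF assms(8) by (simp only: n_def)
  ultimately show ?thesis
    unfolding n_def by (intro conjI ballI)
qed

end
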